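(* Let $0<\varepsilon_1\le\varepsilon_2\le h$ and let $E$ be the quadrilateral with vertices $P_1=(0,h)$, $P_2=(0,0)$, $P_3=(\varepsilon_1,h)$, $P_4=(\varepsilon_2,0)$, and let $\widetilde e$ be the edge joining $P_3$ and $P_4$. For every $v_h\in V_E$ with $v_h|_{\widetilde e}=0$ there holds $$s_E(v_h,v_h)\le|v_h|_{H^1(E)}^2,$$ where $s_E(v,w):=\int_0^h\frac{v(0,y)\,w(0,y)}{\kappa(y)}\,dy$ and $\kappa(y)=(h-y)\frac{\varepsilon_2-\varepsilon_1}{h}+\varepsilon_1$.
   Context: $\kappa(y)$ is the length of the horizontal segment of $E$ at height $y$. $V_E$ is the enhanced virtual element space of order one on $E$: $V_E=\{v\in H^1(E):v_{|\partial E}\in B_{\partial E},\ \Delta v\in\mathbb P_1(E),\ \int_E(v-\Pi^\nabla_Ev)q_1=0\ \forall q_1\in\mathbb P_1(E)\}$, where $B_{\partial E}$ is the space of continuous functions on $\partial E$ affine on each edge, and $\Pi^\nabla_E:H^1(E)\to\mathbb P_1(E)$ is defined by $(\nabla(v-\Pi^\nabla_Ev),\nabla q)_{L^2(E)}=0$ for all $q\in\mathbb P_1(E)$ and $\int_{\partial E}(v-\Pi^\nabla_Ev)=0$. *)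

theory Defs
  imports "HOL-Analysis.Analysis"
begin

section \<open>Square-integrable functions\<close>

definition L2 :: "'a measure \<Rightarrow> ('a \<Rightarrow> 'b::euclidean_space) set" where
  "L2 M = {f \<in> borel_measurable M. integrable M (\<lambda>x. (norm (f x))\<^sup>2)}"

definition L2_tendsto :: "'a measure \<Rightarrow> (nat \<Rightarrow> 'a \<Rightarrow> 'b::euclidean_space) \<Rightarrow> ('a \<Rightarrow> 'b) \<Rightarrow> bool" where
  "L2_tendsto M f g \<longleftrightarrow> (\<forall>n. f n \<in> L2 M) \<and> g \<in> L2 M \<and>
     (\<lambda>n. \<integral>x. (norm (f n x - g x))\<^sup>2 \<partial>M) \<longlonglongrightarrow> 0"


section \<open>Smooth functions and the Sobolev space \<open>H\<^sup>1\<close>\<close>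

definition partial_deriv :: "'a::euclidean_space \<Rightarrow> ('a \<Rightarrow> real) \<Rightarrow> 'a \<Rightarrow> real" where
  "partial_deriv i f x = frechet_derivative f (at x) i"

definition gradient :: "('a::euclidean_space \<Rightarrow> real) \<Rightarrow> 'a \<Rightarrow> 'a" where
  "gradient f x = (\<Sum>i\<in>Basis. partial_deriv i f x *\<^sub>R i)"

definition laplacian :: "('a::euclidean_space \<Rightarrow> real) \<Rightarrow> 'a \<Rightarrow> real" where
  "laplacian f x = (\<Sum>i\<in>Basis. partial_deriv i (partial_deriv i f) x)"

primrec C_k :: "nat \<Rightarrow> ('a::euclidean_space \<Rightarrow> real) \<Rightarrow> bool" where
  "C_k 0 f \<longleftrightarrow> continuous_on UNIV f"
| "C_k (Suc k) f \<longleftrightarrow> (\<forall>x. f differentiable (at x)) \<and> (\<forall>i\<in>Basis. C_k k (partial_deriv i f))"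

definition smooth :: "('a::euclidean_space \<Rightarrow> real) \<Rightarrow> bool" where
  "smooth f \<longleftrightarrow> (\<forall>k. C_k k f)"

definition test_functions :: "'a::euclidean_space set \<Rightarrow> ('a \<Rightarrow> real) set" where
  "test_functions U =
     {\<phi>. smooth \<phi> \<and> compact (closure {x. \<phi> x \<noteq> 0}) \<and> closure {x. \<phi> x \<noteq> 0} \<subseteq> U}"

definition has_weak_gradient ::
    "'a::euclidean_space set \<Rightarrow> ('a \<Rightarrow> real) \<Rightarrow> ('a \<Rightarrow> 'a) \<Rightarrow> bool" where
  "has_weak_gradient U v g \<longleftrightarrow> (\<forall>\<phi>\<in>test_functions U. \<forall>i\<in>Basis.
     (\<integral>x. v x * partial_deriv i \<phi> x \<partial>lebesgue_on U) = - (\<integral>x. (g x \<bullet> i) * \<phi> x \<partial>lebesgue_on U))"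

definition H1 :: "'a::euclidean_space set \<Rightarrow> ('a \<Rightarrow> real) set" where
  "H1 U = {v \<in> L2 (lebesgue_on U). \<exists>g \<in> L2 (lebesgue_on U). has_weak_gradient U v g}"

text \<open>The weak gradient is determined only almost everywhere on \<open>U\<close>; an arbitrary
  representative is chosen.\<close>

definition weak_gradient :: "'a::euclidean_space set \<Rightarrow> ('a \<Rightarrow> real) \<Rightarrow> 'a \<Rightarrow> 'a" where
  "weak_gradient U v = (SOME g. g \<in> L2 (lebesgue_on U) \<and> has_weak_gradient U v g)"

definition H1_seminorm :: "'a::euclidean_space set \<Rightarrow> ('a \<Rightarrow> real) \<Rightarrow> real" where
  "H1_seminorm U v = sqrt (\<integral>x. (norm (weak_gradient U v x))\<^sup>2 \<partial>lebesgue_on U)"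

definition has_distr_laplacian ::
    "'a::euclidean_space set \<Rightarrow> ('a \<Rightarrow> real) \<Rightarrow> ('a \<Rightarrow> real) \<Rightarrow> bool" where
  "has_distr_laplacian U v f \<longleftrightarrow> (\<forall>\<phi>\<in>test_functions U.
     (\<integral>x. v x * laplacian \<phi> x \<partial>lebesgue_on U) = (\<integral>x. f x * \<phi> x \<partial>lebesgue_on U))"

definition P1 :: "('a::euclidean_space \<Rightarrow> real) set" where
  "P1 = {p. \<exists>a c. p = (\<lambda>x. a \<bullet> x + c)}"


section \<open>Convex polygons and traces\<close>

type_synonym plane = "real \<times> real"

text \<open>A convex polygon is given by the list of its vertices in cyclic order. The element itself
  is the open polygon. Functions on an edge from \<open>a\<close> to \<open>b\<close> are handled
  through the parametrisation \<open>linepath a b\<close> of the edge over \<open>{0..1}\<close>, whose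
  speed is \<open>dist a b\<close>.\<close>

definition polygon :: "plane list \<Rightarrow> plane set" where
  "polygon ps = interior (convex hull (set ps))"

definition edges :: "plane list \<Rightarrow> (plane \<times> plane) list" where
  "edges ps = zip ps (rotate1 ps)"

definition boundary_integral :: "plane list \<Rightarrow> (plane \<Rightarrow> real) \<Rightarrow> real" where
  "boundary_integral ps g =
     (\<Sum>(a, b)\<leftarrow>edges ps. dist a b * (\<integral>t. g (linepath a b t) \<partial>lebesgue_on {0..1}))"

definition AE_edge :: "plane \<times> plane \<Rightarrow> (plane \<Rightarrow> bool) \<Rightarrow> bool" where
  "AE_edge e P \<longleftrightarrow> (AE t in lebesgue_on {0..1}. P (linepath (fst e) (snd e) t))"

text \<open>The relation \<open>has_trace\<close> is the graph of the trace operator, the continuous extension to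
  \<open>H\<^sup>1(E)\<close>, with values in \<open>L\<^sup>2(\<partial>E)\<close>, of the restriction to \<open>\<partial>E\<close> of functions smooth up to the
  boundary. As for the weak gradient, \<open>bd_trace\<close> picks a representative; it is meaningful only
  almost everywhere on the boundary.\<close>

definition has_trace :: "plane list \<Rightarrow> (plane \<Rightarrow> real) \<Rightarrow> (plane \<Rightarrow> real) \<Rightarrow> bool" where
  "has_trace ps v g \<longleftrightarrow> (\<exists>\<phi> :: nat \<Rightarrow> plane \<Rightarrow> real.
     (\<forall>n. smooth (\<phi> n)) \<and>
     L2_tendsto (lebesgue_on (polygon ps)) \<phi> v \<and>
     L2_tendsto (lebesgue_on (polygon ps)) (\<lambda>n. gradient (\<phi> n)) (weak_gradient (polygon ps) v) \<and>
     (\<forall>(a, b)\<in>set (edges ps).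
        L2_tendsto (lebesgue_on {0..1}) (\<lambda>n t. \<phi> n (linepath a b t)) (\<lambda>t. g (linepath a b t))))"

definition bd_trace :: "plane list \<Rightarrow> (plane \<Rightarrow> real) \<Rightarrow> plane \<Rightarrow> real" where
  "bd_trace ps v = (SOME g. has_trace ps v g)"


section \<open>The enhanced virtual element space of order one\<close>

definition boundary_space :: "plane list \<Rightarrow> (plane \<Rightarrow> real) set" where
  "boundary_space ps = {g. continuous_on (frontier (polygon ps)) g \<and>
     (\<forall>(a, b)\<in>set (edges ps). \<forall>t\<in>{0..1}. g (linepath a b t) = (1 - t) * g a + t * g b)}"

definition is_Pi_nabla :: "plane list \<Rightarrow> (plane \<Rightarrow> real) \<Rightarrow> (plane \<Rightarrow> real) \<Rightarrow> bool" where
  "is_Pi_nabla ps v p \<longleftrightarrow> p \<in> P1 \<and>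
     (\<forall>q\<in>P1. (\<integral>x. weak_gradient (polygon ps) (\<lambda>x. v x - p x) x \<bullet> weak_gradient (polygon ps) q x
                \<partial>lebesgue_on (polygon ps)) = 0) \<and>
     boundary_integral ps (bd_trace ps (\<lambda>x. v x - p x)) = 0"

definition Pi_nabla :: "plane list \<Rightarrow> (plane \<Rightarrow> real) \<Rightarrow> plane \<Rightarrow> real" where
  "Pi_nabla ps v = (THE p. is_Pi_nabla ps v p)"

definition VEM :: "plane list \<Rightarrow> (plane \<Rightarrow> real) set" where
  "VEM ps = {v \<in> H1 (polygon ps).
     (\<exists>g\<in>boundary_space ps. has_trace ps v g) \<and>
     (\<exists>f\<in>P1. has_distr_laplacian (polygon ps) v f) \<and>
     (\<forall>q\<in>P1. (\<integral>x. (v x - Pi_nabla ps v x) * q x \<partial>lebesgue_on (polygon ps)) = 0)}"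


section \<open>The quadrilateral\<close>

text \<open>\<open>P\<^sub>1, P\<^sub>2, P\<^sub>4, P\<^sub>3\<close> is the cyclic order of the vertices \<open>P\<^sub>1 = (0, h)\<close>, \<open>P\<^sub>2 = (0, 0)\<close>,
  \<open>P\<^sub>3 = (\<epsilon>\<^sub>1, h)\<close>, \<open>P\<^sub>4 = (\<epsilon>\<^sub>2, 0)\<close>.\<close>

definition quad :: "real \<Rightarrow> real \<Rightarrow> real \<Rightarrow> plane list" where
  "quad h \<epsilon>\<^sub>1 \<epsilon>\<^sub>2 = [(0, h), (0, 0), (\<epsilon>\<^sub>2, 0), (\<epsilon>\<^sub>1, h)]"

text \<open>The closure makes the end heights, at which the open polygon has empty section, count too.\<close>

definition kappa :: "plane list \<Rightarrow> real \<Rightarrow> real" where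
  "kappa ps y = measure lborel {x. (x, y) \<in> closure (polygon ps)}"

definition s_form :: "real \<Rightarrow> plane list \<Rightarrow> (plane \<Rightarrow> real) \<Rightarrow> (plane \<Rightarrow> real) \<Rightarrow> real" where
  "s_form h ps v w =
     (\<integral>y. bd_trace ps v (0, y) * bd_trace ps w (0, y) / kappa ps y \<partial>lebesgue_on {0..h})"

end

theory Submission
  imports Defs
begin

text \<open>For \<open>\<phi>\<close> smooth up to the boundary, \<open>\<phi> (0, y) - \<phi> (\<kappa> y, y)\<close> is minus the integral of
  \<open>\<partial>\<phi>/\<partial>x\<close> over a horizontal segment of length \<open>\<kappa> y\<close>. By Cauchy-Schwarz its square divided by
  \<open>\<kappa> y\<close> is at most the integral of \<open>(\<partial>\<phi>/\<partial>x)\<^sup>2\<close> over that segment, and integrating in \<open>y\<close> bounds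
  the weighted increments by \<open>|\<phi>|\<close> in \<open>H\<^sup>1\<close>, squared. Since \<open>\<kappa> \<ge> \<epsilon>\<^sub>1 > 0\<close>, both sides are continuous along the
  smooth approximations that define the trace.\<close>

section \<open>Convergence in L2\<close>

lemma L2_diff:
  assumes "f \<in> L2 M" "g \<in> L2 M"
  shows "(\<lambda>x. f x - g x) \<in> L2 M"
proof -
  have meas: "f \<in> borel_measurable M" "g \<in> borel_measurable M"
    and int: "integrable M (\<lambda>x. (norm (f x))\<^sup>2)" "integrable M (\<lambda>x. (norm (g x))\<^sup>2)"
    using assms by (auto simp: L2_def)
  have "integrable M (\<lambda>x. (norm (f x - g x))\<^sup>2)"
  proof (rule Bochner_Integration.integrable_bound)
    show "integrable M (\<lambda>x. 2 * (norm (f x))\<^sup>2 + 2 * (norm (g x))\<^sup>2)"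
      using int by simp
    show "AE x in M. norm ((norm (f x - g x))\<^sup>2) \<le> norm (2 * (norm (f x))\<^sup>2 + 2 * (norm (g x))\<^sup>2)"
    proof (rule AE_I2)
      fix x
      have "(norm (f x - g x))\<^sup>2 \<le> (norm (f x) + norm (g x))\<^sup>2"
        by (intro power_mono norm_triangle_ineq4) simp
      also have "\<dots> \<le> 2 * (norm (f x))\<^sup>2 + 2 * (norm (g x))\<^sup>2"
        using sum_squares_bound[of "norm (f x)" "norm (g x)"] by (simp add: power2_sum)
      finally show "norm ((norm (f x - g x))\<^sup>2) \<le> norm (2 * (norm (f x))\<^sup>2 + 2 * (norm (g x))\<^sup>2)"
        by simp
    qed
  qed (use meas in measurable)
  then show ?thesis
    using meas by (auto simp: L2_def)
qed

lemma L2_integrable: "f \<in> L2 M \<Longrightarrow> integrable M (\<lambda>x. (norm (f x))\<^sup>2)"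
  by (simp add: L2_def)

text \<open>Young's inequality with a free parameter: the difference of squares is at most
  \<open>d * (2 * norm b + d)\<close> with \<open>d = norm (a - b)\<close>, and the mixed term is
  split with weight \<open>\<delta>\<close>. The fixed quantity \<open>norm b\<close> then carries
  an arbitrarily small factor, which gives continuity of the squared norm without Cauchy-Schwarz in
  L2.\<close>

lemma abs_norm_sq_diff_le:
  fixes a b :: "'a::real_normed_vector"
  assumes "0 < \<delta>"
  shows "\<bar>(norm a)\<^sup>2 - (norm b)\<^sup>2\<bar> \<le> (1 + 1 / \<delta>) * (norm (a - b))\<^sup>2 + \<delta> * (norm b)\<^sup>2"
proof -
  define d where "d = norm (a - b)"
  have d: "\<bar>norm a - norm b\<bar> \<le> d" "norm a \<le> norm b + d" "0 \<le> d"
    unfolding d_def using norm_triangle_ineq3 norm_triangle_sub[of a b] by auto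
  have "\<bar>(norm a)\<^sup>2 - (norm b)\<^sup>2\<bar> = \<bar>norm a - norm b\<bar> * (norm a + norm b)"
    by (simp add: power2_eq_square square_diff_square_factored abs_mult mult.commute)
  also have "\<dots> \<le> d * (2 * norm b + d)"
    by (intro mult_mono) (use d in auto)
  also have "\<dots> \<le> (1 + 1 / \<delta>) * d\<^sup>2 + \<delta> * (norm b)\<^sup>2"
  proof -
    \<comment> \<open>Expanding this gives \<open>2 * d * norm b \<le> d\<^sup>2 / \<delta> +
      \<delta> * (norm b)\<^sup>2\<close>.\<close>
    have "0 \<le> (d - \<delta> * norm b)\<^sup>2 / \<delta>"
      using assms by simp
    then show ?thesis
      using assms by (simp add: power2_eq_square field_simps)
  qed
  finally show ?thesis
    by (simp add: d_def)
qed

text \<open>The pointwise Young bound is integrated. First \<open>\<delta>\<close> is fixed so that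
  the term with \<open>?G\<close> is small, then \<open>n\<close> is taken large so that the term
  with \<open>?D n\<close> is small.\<close>

lemma L2_tendsto_integral_norm:
  assumes "L2_tendsto M f g"
  shows "(\<lambda>n. \<integral>x. (norm (f n x))\<^sup>2 \<partial>M) \<longlonglongrightarrow> (\<integral>x. (norm (g x))\<^sup>2 \<partial>M)"
proof -
  let ?G = "\<integral>x. (norm (g x))\<^sup>2 \<partial>M"
  let ?D = "\<lambda>n. \<integral>x. (norm (f n x - g x))\<^sup>2 \<partial>M"
  have L2: "f n \<in> L2 M" "g \<in> L2 M" for n
    using assms by (auto simp: L2_tendsto_def)
  note int = L2_integrable[OF L2(1)] L2_integrable[OF L2(2)] L2_integrable[OF L2_diff[OF L2]]
  have le: "\<bar>(\<integral>x. (norm (f n x))\<^sup>2 \<partial>M) - ?G\<bar> \<le> (1 + 1 / \<delta>) * ?D n + \<delta> * ?G" if "0 < \<delta>" for n \<delta>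
  proof -
    have "\<bar>(\<integral>x. (norm (f n x))\<^sup>2 \<partial>M) - ?G\<bar> = \<bar>\<integral>x. (norm (f n x))\<^sup>2 - (norm (g x))\<^sup>2 \<partial>M\<bar>"
      using int by simp
    also have "\<dots> \<le> (\<integral>x. \<bar>(norm (f n x))\<^sup>2 - (norm (g x))\<^sup>2\<bar> \<partial>M)"
      by (rule integral_abs_bound)
    also have "\<dots> \<le> (\<integral>x. (1 + 1 / \<delta>) * (norm (f n x - g x))\<^sup>2 + \<delta> * (norm (g x))\<^sup>2 \<partial>M)"
      using int abs_norm_sq_diff_le[OF that] by (intro integral_mono) auto
    also have "\<dots> = (1 + 1 / \<delta>) * ?D n + \<delta> * ?G"
      using int by simp
    finally show ?thesis .
  qed
  have G: "0 \<le> ?G" by simp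
  show ?thesis
  proof (rule LIMSEQ_I)
    fix r :: real assume "0 < r"
    have "0 < ?G + 1"
      using G by (rule add_nonneg_pos) simp
    \<comment> \<open>The witness is \<open>\<delta> = r / 2 / (?G + 1)\<close>. The summand 1
      avoids division by zero when \<open>?G\<close> vanishes and makes
      \<open>\<delta> * ?G < r / 2\<close> strict.\<close>
    then have "0 < r / 2 / (?G + 1)" "r / 2 / (?G + 1) * (?G + 1) = r / 2"
      using \<open>0 < r\<close> by (simp, metis \<open>0 < ?G + 1\<close> less_irrefl nonzero_eq_divide_eq)
    then obtain \<delta> where "0 < \<delta>" "\<delta> * (?G + 1) = r / 2"
      by blast
    then have \<delta>: "0 < \<delta>" "\<delta> * ?G < r / 2"
      by (simp_all add: distrib_left)
    have "(\<lambda>n. (1 + 1 / \<delta>) * ?D n) \<longlonglongrightarrow> (1 + 1 / \<delta>) * 0"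
      using assms by (intro tendsto_mult_left) (simp add: L2_tendsto_def)
    then have "\<forall>\<^sub>F n in sequentially. (1 + 1 / \<delta>) * ?D n < r / 2"
      using \<open>0 < r\<close> by (intro order_tendstoD) auto
    then obtain N where "\<And>n. n \<ge> N \<Longrightarrow> (1 + 1 / \<delta>) * ?D n < r / 2"
      by (auto simp: eventually_sequentially)
    then have "\<And>n. n \<ge> N \<Longrightarrow> \<bar>(\<integral>x. (norm (f n x))\<^sup>2 \<partial>M) - ?G\<bar> < r"
      using le[OF \<delta>(1)] \<delta>(2) by (smt (verit) field_sum_of_halves)
    then show "\<exists>N. \<forall>n\<ge>N. norm ((\<integral>x. (norm (f n x))\<^sup>2 \<partial>M) - ?G) < r"
      by auto
  qed
qed

lemma L2_tendsto_diff:
  assumes "L2_tendsto M f g" "L2_tendsto M f' g'"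
  shows "L2_tendsto M (\<lambda>n x. f n x - f' n x) (\<lambda>x. g x - g' x)"
proof -
  have L2: "f n \<in> L2 M" "f' n \<in> L2 M" "g \<in> L2 M" "g' \<in> L2 M" for n
    using assms by (auto simp: L2_tendsto_def)
  let ?a = "\<lambda>n x. f n x - g x" and ?b = "\<lambda>n x. f' n x - g' x"
  have L2': "?a n \<in> L2 M" "?b n \<in> L2 M" for n
    by (intro L2_diff L2)+
  have int: "integrable M (\<lambda>x. (norm (f n x - f' n x - (g x - g' x)))\<^sup>2)" for n
    using L2_diff[OF L2_diff[OF L2(1,2)] L2_diff[OF L2(3,4)]] by (rule L2_integrable)
  have le: "(\<integral>x. (norm (f n x - f' n x - (g x - g' x)))\<^sup>2 \<partial>M)
      \<le> 2 * (\<integral>x. (norm (?a n x))\<^sup>2 \<partial>M) + 2 * (\<integral>x. (norm (?b n x))\<^sup>2 \<partial>M)" for n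
  proof -
    have "(norm (f n x - f' n x - (g x - g' x)))\<^sup>2 \<le> 2 * (norm (?a n x))\<^sup>2 + 2 * (norm (?b n x))\<^sup>2" for x
    proof -
      have "f n x - f' n x - (g x - g' x) = ?a n x - ?b n x"
        by simp
      then have "(norm (f n x - f' n x - (g x - g' x)))\<^sup>2 \<le> (norm (?a n x) + norm (?b n x))\<^sup>2"
        by (metis norm_ge_zero norm_triangle_ineq4 power_mono)
      also have "\<dots> \<le> 2 * (norm (?a n x))\<^sup>2 + 2 * (norm (?b n x))\<^sup>2"
        using sum_squares_bound[of "norm (?a n x)" "norm (?b n x)"] by (simp add: power2_sum)
      finally show ?thesis .
    qed
    then have "(\<integral>x. (norm (f n x - f' n x - (g x - g' x)))\<^sup>2 \<partial>M)
      \<le> (\<integral>x. 2 * (norm (?a n x))\<^sup>2 + 2 * (norm (?b n x))\<^sup>2 \<partial>M)"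
      using int L2'[THEN L2_integrable] by (intro integral_mono) auto
    then show ?thesis
      using L2'[THEN L2_integrable] by simp
  qed
  have lim: "(\<lambda>n. 2 * (\<integral>x. (norm (?a n x))\<^sup>2 \<partial>M) + 2 * (\<integral>x. (norm (?b n x))\<^sup>2 \<partial>M)) \<longlonglongrightarrow> 0"
    using assms by (auto simp: L2_tendsto_def intro!: tendsto_add_zero tendsto_mult_right_zero)
  have "(\<lambda>n. \<integral>x. (norm (f n x - f' n x - (g x - g' x)))\<^sup>2 \<partial>M) \<longlonglongrightarrow> 0"
    by (rule Lim_null_comparison[OF always_eventually lim]) (use le in simp)
  then show ?thesis
    unfolding L2_tendsto_def using L2 by (simp add: L2_diff)
qed

section \<open>Multiplication by a bounded weight, and change of the limit on a null set\<close>

lemma L2_mult_bounded: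
  fixes f :: "'a \<Rightarrow> real"
  assumes "f \<in> L2 M" "c \<in> borel_measurable M" "\<And>x. x \<in> space M \<Longrightarrow> \<bar>c x\<bar> \<le> B"
  shows "(\<lambda>x. c x * f x) \<in> L2 M"
    and "(\<integral>x. (norm (c x * f x))\<^sup>2 \<partial>M) \<le> B\<^sup>2 * (\<integral>x. (norm (f x))\<^sup>2 \<partial>M)"
proof -
  have f: "f \<in> borel_measurable M" "integrable M (\<lambda>x. (norm (f x))\<^sup>2)"
    using assms(1) by (auto simp: L2_def)
  have le: "(norm (c x * f x))\<^sup>2 \<le> B\<^sup>2 * (norm (f x))\<^sup>2" if "x \<in> space M" for x
    using power_mono[OF assms(3)[OF that], of 2]
    by (auto simp: abs_mult power_mult_distrib intro!: mult_right_mono)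
  have int: "integrable M (\<lambda>x. (norm (c x * f x))\<^sup>2)"
  proof (rule Bochner_Integration.integrable_bound)
    show "integrable M (\<lambda>x. B\<^sup>2 * (norm (f x))\<^sup>2)"
      using f by simp
    show "AE x in M. norm ((norm (c x * f x))\<^sup>2) \<le> norm (B\<^sup>2 * (norm (f x))\<^sup>2)"
      using le by (intro AE_I2) (auto simp: abs_mult)
  qed (use f assms(2) in measurable)
  then show "(\<lambda>x. c x * f x) \<in> L2 M"
    using f assms(2) by (auto simp: L2_def)
  have "(\<integral>x. (norm (c x * f x))\<^sup>2 \<partial>M) \<le> (\<integral>x. B\<^sup>2 * (norm (f x))\<^sup>2 \<partial>M)"
    using int f le by (intro integral_mono) auto
  then show "(\<integral>x. (norm (c x * f x))\<^sup>2 \<partial>M) \<le> B\<^sup>2 * (\<integral>x. (norm (f x))\<^sup>2 \<partial>M)"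
    using f by simp
qed

lemma L2_tendsto_mult_bounded:
  fixes f :: "nat \<Rightarrow> 'a \<Rightarrow> real"
  assumes "L2_tendsto M f g" "c \<in> borel_measurable M" "\<And>x. x \<in> space M \<Longrightarrow> \<bar>c x\<bar> \<le> B"
  shows "L2_tendsto M (\<lambda>n x. c x * f n x) (\<lambda>x. c x * g x)"
proof -
  have L2: "f n \<in> L2 M" "g \<in> L2 M" and lim: "(\<lambda>n. \<integral>x. (norm (f n x - g x))\<^sup>2 \<partial>M) \<longlonglongrightarrow> 0" for n
    using assms by (auto simp: L2_tendsto_def)
  have "(\<lambda>n. \<integral>x. (norm (c x * f n x - c x * g x))\<^sup>2 \<partial>M) \<longlonglongrightarrow> 0"
  proof (rule tendsto_sandwich[OF _ _ tendsto_const])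
    show "\<forall>\<^sub>F n in sequentially. (\<integral>x. (norm (c x * f n x - c x * g x))\<^sup>2 \<partial>M)
        \<le> B\<^sup>2 * (\<integral>x. (norm (f n x - g x))\<^sup>2 \<partial>M)"
      using L2_mult_bounded(2)[OF L2_diff[OF L2] assms(2,3)]
      by (simp add: right_diff_distrib)
    show "(\<lambda>n. B\<^sup>2 * (\<integral>x. (norm (f n x - g x))\<^sup>2 \<partial>M)) \<longlonglongrightarrow> 0"
      using tendsto_mult_left[OF lim, of "B\<^sup>2"] by simp
  qed auto
  then show ?thesis
    using L2_mult_bounded(1)[OF L2(1) assms(2,3)] L2_mult_bounded(1)[OF L2(2) assms(2,3)]
    by (auto simp: L2_tendsto_def)
qed

text \<open>The trace vanishes on the slanted edge only almost everywhere, so its limit there has to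
  be exchanged for the constant 0. Measurability of \<open>g'\<close> is assumed because a general
  measure need not be complete.\<close>

lemma L2_tendsto_cong_AE:
  assumes "L2_tendsto M f g" "AE x in M. g x = g' x" "g' \<in> borel_measurable M"
  shows "L2_tendsto M f g'"
proof -
  have f: "f n \<in> borel_measurable M" and g: "g \<in> borel_measurable M" for n
    using assms(1) by (auto simp: L2_tendsto_def L2_def)
  have "integrable M (\<lambda>x. (norm (g' x))\<^sup>2) \<longleftrightarrow> integrable M (\<lambda>x. (norm (g x))\<^sup>2)"
    using assms g by (intro integrable_cong_AE) auto
  moreover have "(\<integral>x. (norm (f n x - g' x))\<^sup>2 \<partial>M) = (\<integral>x. (norm (f n x - g x))\<^sup>2 \<partial>M)" for n
    using assms f g by (intro integral_cong_AE) auto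
  ultimately show ?thesis
    using assms by (auto simp: L2_tendsto_def L2_def)
qed

section \<open>Affine changes of variable between subsets of the line\<close>

lemma lebesgue_on_real_affine:
  fixes f :: "real \<Rightarrow> 'a::euclidean_space" and c t :: real
  assumes "c \<noteq> 0" "S \<in> sets lebesgue" "T \<in> sets lebesgue" "\<And>y. y \<in> T \<longleftrightarrow> t + c * y \<in> S"
  shows "integrable (lebesgue_on T) (\<lambda>y. f (t + c * y)) \<longleftrightarrow> integrable (lebesgue_on S) f"
    and "(\<integral>x. f x \<partial>lebesgue_on S) = \<bar>c\<bar> *\<^sub>R (\<integral>y. f (t + c * y) \<partial>lebesgue_on T)"
    and "f \<in> borel_measurable (lebesgue_on S) \<Longrightarrow> (\<lambda>y. f (t + c * y)) \<in> borel_measurable (lebesgue_on T)"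
proof -
  \<comment> \<open>Extension by zero reduces the claims to the change of variables on the whole
    line. As \<open>T\<close> is the preimage of \<open>S\<close>, composing the extension with the
    affine map gives the extension by zero of the composed function.\<close>
  define F where "F = (\<lambda>x. if x \<in> S then f x else 0)"
  have F: "F (t + c * y) = (if y \<in> T then f (t + c * y) else 0)" for y
    by (simp add: F_def assms(4))
  show "integrable (lebesgue_on T) (\<lambda>y. f (t + c * y)) \<longleftrightarrow> integrable (lebesgue_on S) f"
    using lebesgue_integrable_real_affine_iff[OF assms(1), of F t]
      Lebesgue_Measure.integrable_restrict_UNIV[OF assms(2), of f]
      Lebesgue_Measure.integrable_restrict_UNIV[OF assms(3), of "\<lambda>y. f (t + c * y)"]
    unfolding F unfolding F_def by blast
  show "(\<integral>x. f x \<partial>lebesgue_on S) = \<bar>c\<bar> *\<^sub>R (\<integral>y. f (t + c * y) \<partial>lebesgue_on T)"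
    using lebesgue_integral_real_affine[OF assms(1), of F t]
    unfolding F unfolding F_def by (simp only: Lebesgue_Measure.integral_restrict_UNIV[OF assms(2)] Lebesgue_Measure.integral_restrict_UNIV[OF assms(3)])
  show "(\<lambda>y. f (t + c * y)) \<in> borel_measurable (lebesgue_on T)" if "f \<in> borel_measurable (lebesgue_on S)"
    using borel_measurable_affine[OF borel_measurable_if_I[OF that assms(2)] assms(1), of t]
    by (simp add: assms(4)[symmetric] borel_measurable_if assms(3))
qed

lemma L2_real_affine:
  fixes c t :: real
  assumes "f \<in> L2 (lebesgue_on S)"
    "c \<noteq> 0" "S \<in> sets lebesgue" "T \<in> sets lebesgue" "\<And>y. y \<in> T \<longleftrightarrow> t + c * y \<in> S"
  shows "(\<lambda>y. f (t + c * y)) \<in> L2 (lebesgue_on T)"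
  using assms(1) lebesgue_on_real_affine(3)[OF assms(2-), of f]
    lebesgue_on_real_affine(1)[OF assms(2-), of "\<lambda>x. (norm (f x))\<^sup>2"]
  by (auto simp: L2_def)

text \<open>Traces converge in the edge parameter over \<open>{0..1}\<close>, while
  \<open>s_form\<close> integrates over heights in \<open>{0..h}\<close>. Both are related by an
  affine map, which changes squared L2 distances only by the constant factor
  \<open>1 / \<bar>c\<bar>\<close>.\<close>

lemma L2_tendsto_real_affine:
  fixes c t :: real
  assumes "L2_tendsto (lebesgue_on S) f g"
    "c \<noteq> 0" "S \<in> sets lebesgue" "T \<in> sets lebesgue" "\<And>y. y \<in> T \<longleftrightarrow> t + c * y \<in> S"
  shows "L2_tendsto (lebesgue_on T) (\<lambda>n y. f n (t + c * y)) (\<lambda>y. g (t + c * y))"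
proof -
  have lim: "(\<lambda>n. \<integral>x. (norm (f n x - g x))\<^sup>2 \<partial>lebesgue_on S) \<longlonglongrightarrow> 0"
    using assms by (auto simp: L2_tendsto_def)
  have "(\<integral>y. (norm (f n (t + c * y) - g (t + c * y)))\<^sup>2 \<partial>lebesgue_on T)
      = 1 / \<bar>c\<bar> * (\<integral>x. (norm (f n x - g x))\<^sup>2 \<partial>lebesgue_on S)" for n
    using lebesgue_on_real_affine(2)[OF assms(2-), of "\<lambda>x. (norm (f n x - g x))\<^sup>2"] assms(2)
    by simp
  then show ?thesis
    using assms(1) tendsto_mult_left[OF lim, of "1 / \<bar>c\<bar>"] L2_real_affine[OF _ assms(2-)]
    by (auto simp: L2_tendsto_def)
qed

section \<open>Horizontal increments of smooth functions\<close>

text \<open>This is the estimate on a single horizontal segment. The right-hand side is a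
  nonnegative integral so that Tonelli applies afterwards; the interval is open to match the
  sections of an open region, and its endpoints are null.\<close>

lemma increment_sq_le:
  fixes F F' :: "real \<Rightarrow> real"
  assumes "0 < K" and F: "\<And>x. x \<in> {0..K} \<Longrightarrow> (F has_real_derivative F' x) (at x)"
    and cont: "continuous_on {0..K} F'"
  shows "ennreal ((F 0 - F K)\<^sup>2 / K) \<le> (\<integral>\<^sup>+x. ennreal ((F' x)\<^sup>2) * indicator {0<..<K} x \<partial>lborel)"
proof -
  define m where "m = (F K - F 0) / K"
  have F': "(F' has_integral (F K - F 0)) {0..K}"
    using F assms(1)
    by (intro fundamental_theorem_of_calculus)
       (auto simp: has_real_derivative_iff_has_vector_derivative[symmetric] intro: DERIV_subset)
  obtain I where I: "((\<lambda>x. (F' x)\<^sup>2) has_integral I) {0..K}"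
    using integrable_continuous_interval[of 0 K "\<lambda>x. (F' x)\<^sup>2"] cont
    by (auto intro!: continuous_intros simp: integrable_on_def)
  have "((\<lambda>x. (F' x)\<^sup>2 - 2 * m * F' x + m\<^sup>2) has_integral (I - 2 * m * (F K - F 0) + m\<^sup>2 * K)) {0..K}"
    using has_integral_const_real[of "m\<^sup>2" 0 K] assms(1)
    by (intro has_integral_add has_integral_diff has_integral_mult_right I F') (simp add: mult.commute)
  \<comment> \<open>Cauchy-Schwarz, from nonnegativity of the variance of \<open>F'\<close> about its mean \<open>m\<close>.\<close>
  moreover have "(F' x)\<^sup>2 - 2 * m * F' x + m\<^sup>2 = (F' x - m)\<^sup>2" for x
    by (simp add: power2_diff)
  ultimately have "0 \<le> I - 2 * m * (F K - F 0) + m\<^sup>2 * K"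
    using has_integral_nonneg by (metis (no_types, lifting) zero_le_power2)
  \<comment> \<open>By the choice of \<open>m\<close>, the middle term is
    \<open>- 2 * (F 0 - F K)\<^sup>2 / K\<close> and the last one is
    \<open>(F 0 - F K)\<^sup>2 / K\<close>.\<close>
  also have "\<dots> = I - (F 0 - F K)\<^sup>2 / K"
    using assms(1) by (simp add: m_def power2_eq_square field_simps)
  finally have "(F 0 - F K)\<^sup>2 / K \<le> I" by simp
  moreover have "(\<integral>\<^sup>+x. ennreal ((F' x)\<^sup>2) * indicator {0<..<K} x \<partial>lborel) = ennreal I"
    using I by (intro nn_integral_has_integral_lebesgue') (auto simp: has_integral_Icc_iff_Ioo)
  ultimately show ?thesis
    by (simp add: ennreal_leI)
qed

section \<open>Partial derivatives of smooth functions\<close>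

lemma smooth_continuous_partial_deriv:
  assumes "smooth \<phi>" "i \<in> Basis"
  shows "continuous_on UNIV (partial_deriv i \<phi>)"
proof -
  have "C_k (Suc 0) \<phi>"
    using assms by (auto simp: smooth_def)
  then show ?thesis
    using assms(2) by simp
qed

lemma smooth_differentiable:
  assumes "smooth \<phi>"
  shows "\<phi> differentiable (at x)"
proof -
  have "C_k (Suc 0) \<phi>"
    using assms by (auto simp: smooth_def)
  then show ?thesis
    by simp
qed

lemma smooth_has_real_derivative_fst:
  assumes "smooth (\<phi> :: plane \<Rightarrow> real)"
  shows "((\<lambda>x. \<phi> (x, y)) has_real_derivative partial_deriv (1, 0) \<phi> (x, y)) (at x)"
proof -
  let ?D = "frechet_derivative \<phi> (at (x, y))"
  have D: "(\<phi> has_derivative ?D) (at (x, y))"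
    using smooth_differentiable[OF assms] frechet_derivative_works by blast
  have "((\<lambda>x. \<phi> (x, y)) has_derivative (\<lambda>t. ?D (t, 0))) (at x)"
    by (rule has_derivative_compose[of "\<lambda>x. (x, y)", OF _ D]) (auto intro!: derivative_eq_intros)
  moreover have "?D (t, 0) = partial_deriv (1, 0) \<phi> (x, y) * t" for t
    using linear_scale[OF has_derivative_linear[OF D], of t "(1, 0)"]
    by (simp add: partial_deriv_def)
  ultimately show ?thesis
    by (simp add: has_field_derivative_def)
qed

lemma partial_deriv_sq_le_gradient:
  assumes "i \<in> Basis"
  shows "(partial_deriv i \<phi> x)\<^sup>2 \<le> (norm (gradient \<phi> x))\<^sup>2"
proof -
  have "gradient \<phi> x \<bullet> i = partial_deriv i \<phi> x"
    unfolding gradient_def using assms by (simp add: inner_sum_left inner_Basis if_distrib cong: if_cong)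
  then have "\<bar>partial_deriv i \<phi> x\<bar> \<le> norm (gradient \<phi> x)"
    using Basis_le_norm[OF assms] by metis
  then show ?thesis
    by (metis abs_ge_zero power2_abs power_mono)
qed

text \<open>The segment estimates are integrated over the height. By Tonelli the result is the
  integral of \<open>(partial_deriv (1, 0) \<phi>)\<^sup>2\<close> over the region swept by the
  segments; passing to the full gradient and to the larger set \<open>E\<close> only increases it.
  The chain runs in \<open>ennreal\<close>, and the two integrability assumptions turn its ends into
  real integrals.\<close>

lemma slice_increment_le_gradient:
  fixes \<phi> :: "plane \<Rightarrow> real" and K :: "real \<Rightarrow> real"
  assumes \<phi>: "smooth \<phi>" and K: "continuous_on UNIV K" "\<And>y. y \<in> {0<..<h} \<Longrightarrow> 0 < K y"
    and E: "{(x, y). 0 < y \<and> y < h \<and> 0 < x \<and> x < K y} \<subseteq> E" "E \<in> sets lebesgue"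
    and int: "integrable (lebesgue_on {0..h}) (\<lambda>y. (\<phi> (0, y) - \<phi> (K y, y))\<^sup>2 / K y)"
      "integrable (lebesgue_on E) (\<lambda>z. (norm (gradient \<phi> z))\<^sup>2)"
    and Kh: "\<And>y. y \<in> {0..h} \<Longrightarrow> 0 \<le> K y"
  shows "(\<integral>y. (\<phi> (0, y) - \<phi> (K y, y))\<^sup>2 / K y \<partial>lebesgue_on {0..h})
    \<le> (\<integral>z. (norm (gradient \<phi> z))\<^sup>2 \<partial>lebesgue_on E)"
proof -
  define E0 where "E0 = {(x, y). 0 < y \<and> y < h \<and> 0 < x \<and> x < K y}"
  \<comment> \<open>Openness makes \<open>E0\<close> Borel, so that the integrand \<open>?g\<close>
    is measurable for the product of the two copies of \<open>lborel\<close>.\<close>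
  have "open E0"
    unfolding E0_def case_prod_unfold
    by (intro open_Collect_conj open_Collect_less continuous_intros
        continuous_on_compose2[OF K(1)]) auto
  then have E0[measurable]: "E0 \<in> sets borel"
    by simp
  have pd[measurable]: "partial_deriv (1, 0) \<phi> \<in> borel_measurable borel"
    using smooth_continuous_partial_deriv[OF \<phi>, of "(1, 0)"]
    by (intro borel_measurable_continuous_onI) (auto simp: Basis_prod_def)
  let ?d = "\<lambda>y. (\<phi> (0, y) - \<phi> (K y, y))\<^sup>2 / K y"
  let ?g = "\<lambda>z. ennreal ((partial_deriv (1, 0) \<phi> z)\<^sup>2) * indicator E0 z"
  \<comment> \<open>At heights 0 and \<open>h\<close> the section of \<open>E0\<close> is empty
    although \<open>{0..h}\<close> contains both; these two heights form a null set. Outside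
    \<open>{0..h}\<close> the left-hand side is 0.\<close>
  have slice: "ennreal (?d y) * indicator {0..h} y \<le> (\<integral>\<^sup>+x. ?g (x, y) \<partial>lborel)"
    if "y \<noteq> 0" "y \<noteq> h" for y
  proof (cases "y \<in> {0<..<h}")
    case True
    have "continuous_on {0..K y} (\<lambda>x. partial_deriv (1, 0) \<phi> (x, y))"
      using smooth_continuous_partial_deriv[OF \<phi>, of "(1, 0)"]
      by (rule continuous_on_compose2) (auto simp: Basis_prod_def intro!: continuous_intros)
    then have "ennreal (?d y)
        \<le> (\<integral>\<^sup>+x. ennreal ((partial_deriv (1, 0) \<phi> (x, y))\<^sup>2) * indicator {0<..<K y} x \<partial>lborel)"
      using K(2)[OF True] smooth_has_real_derivative_fst[OF \<phi>] by (intro increment_sq_le) auto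
    also have "\<dots> = (\<integral>\<^sup>+x. ?g (x, y) \<partial>lborel)"
      using True by (intro nn_integral_cong) (auto simp: E0_def indicator_def)
    finally show ?thesis
      using True by simp
  qed (use that in auto)
  have "ennreal (\<integral>y. ?d y \<partial>lebesgue_on {0..h}) = (\<integral>\<^sup>+y. ennreal (?d y) \<partial>lebesgue_on {0..h})"
    using int(1) Kh by (intro nn_integral_eq_integral[symmetric] AE_I2) auto
  \<comment> \<open>Lebesgue measure is the completion of \<open>lborel\<close> and has the same
    nonnegative integrals; the product structure used next belongs to \<open>lborel\<close>.\<close>
  also have "\<dots> = (\<integral>\<^sup>+y. ennreal (?d y) * indicator {0..h} y \<partial>lborel)"
    by (simp add: nn_integral_restrict_space nn_integral_completion)
  also have "\<dots> \<le> (\<integral>\<^sup>+y. (\<integral>\<^sup>+x. ?g (x, y) \<partial>lborel) \<partial>lborel)"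
  proof (rule nn_integral_mono_AE)
    show "AE y in lborel. ennreal (?d y) * indicator {0..h} y \<le> (\<integral>\<^sup>+x. ?g (x, y) \<partial>lborel)"
      using AE_lborel_singleton[of 0] AE_lborel_singleton[of h] by eventually_elim (rule slice)
  qed
  \<comment> \<open>Tonelli with the first coordinate as inner variable, hence
    \<open>nn_integral_snd\<close>.\<close>
  also have "\<dots> = (\<integral>\<^sup>+z. ?g z \<partial>(lborel \<Otimes>\<^sub>M lborel))"
    by (intro lborel_pair.nn_integral_snd) (simp add: lborel_prod)
  also have "\<dots> = (\<integral>\<^sup>+z. ?g z \<partial>lborel)"
    by (simp add: lborel_prod)
  also have "\<dots> \<le> (\<integral>\<^sup>+z. ennreal ((norm (gradient \<phi> z))\<^sup>2) * indicator E z \<partial>lborel)"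
    using E(1) partial_deriv_sq_le_gradient[of "(1, 0)" \<phi>]
    by (intro nn_integral_mono) (auto simp: E0_def[symmetric] Basis_prod_def indicator_def intro!: ennreal_leI)
  also have "\<dots> = (\<integral>\<^sup>+z. ennreal ((norm (gradient \<phi> z))\<^sup>2) \<partial>lebesgue_on E)"
    using E(2) by (simp add: nn_integral_restrict_space nn_integral_completion)
  also have "\<dots> = ennreal (\<integral>z. (norm (gradient \<phi> z))\<^sup>2 \<partial>lebesgue_on E)"
    using int(2) by (intro nn_integral_eq_integral) auto
  finally show ?thesis
    by (subst (asm) ennreal_le_iff) auto
qed

section \<open>The quadrilateral\<close>

text \<open>The right-hand side is an intersection of four half-planes, hence convex, and it
  contains the vertices. Conversely, each of its points lies on a horizontal segment joining a point
  of the left edge to a point of the slanted edge.\<close>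

lemma hull_quad:
  assumes "0 < h" "0 < \<epsilon>\<^sub>1" "\<epsilon>\<^sub>1 \<le> \<epsilon>\<^sub>2"
  shows "convex hull (set (quad h \<epsilon>\<^sub>1 \<epsilon>\<^sub>2)) =
    {(x, y). 0 \<le> y \<and> y \<le> h \<and> 0 \<le> x \<and> x \<le> (h - y) * ((\<epsilon>\<^sub>2 - \<epsilon>\<^sub>1) / h) + \<epsilon>\<^sub>1}" (is "_ = ?Q")
proof
  let ?r = "(\<epsilon>\<^sub>2 - \<epsilon>\<^sub>1) / h"
  \<comment> \<open>Stated for an arbitrary slope \<open>r\<close>, so that the identity involves no
    quotient.\<close>
  have "{(x, y). 0 \<le> y \<and> y \<le> h \<and> 0 \<le> x \<and> x \<le> (h - y) * r + \<epsilon>\<^sub>1} =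
      {z. (0, -1) \<bullet> z \<le> 0} \<inter> {z. (0, 1) \<bullet> z \<le> h} \<inter> {z. (-1, 0) \<bullet> z \<le> 0}
      \<inter> {z. (1, r) \<bullet> z \<le> h * r + \<epsilon>\<^sub>1}" for r
    by (auto simp: algebra_simps)
  then have "convex ?Q"
    by (simp only:) (intro convex_Int convex_halfspace_le)
  moreover have "set (quad h \<epsilon>\<^sub>1 \<epsilon>\<^sub>2) \<subseteq> ?Q"
    using assms by (auto simp: quad_def)
  ultimately show "convex hull (set (quad h \<epsilon>\<^sub>1 \<epsilon>\<^sub>2)) \<subseteq> ?Q"
    by (rule hull_minimal[rotated])
  show "?Q \<subseteq> convex hull (set (quad h \<epsilon>\<^sub>1 \<epsilon>\<^sub>2))"
  proof clarify
    fix x y assume y: "0 \<le> y" "y \<le> h" and x: "0 \<le> x" "x \<le> (h - y) * ?r + \<epsilon>\<^sub>1"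
    let ?C = "convex hull (set (quad h \<epsilon>\<^sub>1 \<epsilon>\<^sub>2))" and ?K = "(h - y) * ?r + \<epsilon>\<^sub>1"
    \<comment> \<open>Relative height of the point, and its relative position on the horizontal
      segment at that height.\<close>
    define t s where "t = y / h" and "s = x / ?K"
    have "0 \<le> (h - y) * ?r"
      using assms y by simp
    then have K: "0 < ?K"
      using assms(2) by linarith
    have t: "0 \<le> t" "t \<le> 1" and s: "0 \<le> s" "s \<le> 1"
      using x y K assms by (auto simp: t_def s_def)
    have V: "(0, h) \<in> ?C" "(0, 0) \<in> ?C" "(\<epsilon>\<^sub>2, 0) \<in> ?C" "(\<epsilon>\<^sub>1, h) \<in> ?C"
      by (auto simp: quad_def intro!: hull_inc)
    have comb: "(1 - u) *\<^sub>R a + u *\<^sub>R b \<in> ?C" if "a \<in> ?C" "b \<in> ?C" "0 \<le> u" "u \<le> 1" for a b u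
      using that convex_convex_hull by (intro convexD) auto
    \<comment> \<open>The inner combinations are the endpoints \<open>(0, y)\<close> and
      \<open>(?K, y)\<close> of the horizontal segment.\<close>
    have "(1 - s) *\<^sub>R ((1 - t) *\<^sub>R (0, 0) + t *\<^sub>R (0, h)) + s *\<^sub>R ((1 - t) *\<^sub>R (\<epsilon>\<^sub>2, 0) + t *\<^sub>R (\<epsilon>\<^sub>1, h)) \<in> ?C"
      by (intro comb V s t)
    moreover have "(1 - t) * \<epsilon>\<^sub>2 + t * \<epsilon>\<^sub>1 = ?K"
      using assms by (simp add: t_def field_simps)
    moreover have "s * ?K = x" "t * h = y"
      using K assms by (auto simp: s_def t_def)
    moreover have "(1 - s) * (t * h) + s * (t * h) = t * h"
      by (simp add: algebra_simps)
    ultimately show "(x, y) \<in> ?C"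
      by simp
  qed
qed

lemma interior_subset_polygon_quad:
  assumes "0 < h" "0 < \<epsilon>\<^sub>1" "\<epsilon>\<^sub>1 \<le> \<epsilon>\<^sub>2"
  shows "{(x, y). 0 < y \<and> y < h \<and> 0 < x \<and> x < (h - y) * ((\<epsilon>\<^sub>2 - \<epsilon>\<^sub>1) / h) + \<epsilon>\<^sub>1}
    \<subseteq> polygon (quad h \<epsilon>\<^sub>1 \<epsilon>\<^sub>2)"
  unfolding polygon_def hull_quad[OF assms] case_prod_unfold
  by (intro interior_maximal open_Collect_conj open_Collect_less continuous_intros) auto

text \<open>A convex set with nonempty interior has the same closure as its interior, and the hull
  of finitely many points is already closed.\<close>

lemma closure_polygon_quad:
  assumes "0 < h" "0 < \<epsilon>\<^sub>1" "\<epsilon>\<^sub>1 \<le> \<epsilon>\<^sub>2"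
  shows "closure (polygon (quad h \<epsilon>\<^sub>1 \<epsilon>\<^sub>2)) =
    {(x, y). 0 \<le> y \<and> y \<le> h \<and> 0 \<le> x \<and> x \<le> (h - y) * ((\<epsilon>\<^sub>2 - \<epsilon>\<^sub>1) / h) + \<epsilon>\<^sub>1}"
proof -
  \<comment> \<open>The width at half height is at least \<open>\<epsilon>\<^sub>1\<close>, so
    \<open>(\<epsilon>\<^sub>1 / 2, h / 2)\<close> witnesses that the interior is nonempty.\<close>
  have "0 \<le> (h - h / 2) * ((\<epsilon>\<^sub>2 - \<epsilon>\<^sub>1) / h)"
    using assms by (intro mult_nonneg_nonneg) auto
  then have "\<epsilon>\<^sub>1 / 2 < (h - h / 2) * ((\<epsilon>\<^sub>2 - \<epsilon>\<^sub>1) / h) + \<epsilon>\<^sub>1"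
    using assms(2) by linarith
  then have "(\<epsilon>\<^sub>1 / 2, h / 2) \<in> polygon (quad h \<epsilon>\<^sub>1 \<epsilon>\<^sub>2)"
    using assms by (intro interior_subset_polygon_quad[OF assms, THEN subsetD]) auto
  then have "closure (polygon (quad h \<epsilon>\<^sub>1 \<epsilon>\<^sub>2)) = closure (convex hull (set (quad h \<epsilon>\<^sub>1 \<epsilon>\<^sub>2)))"
    unfolding polygon_def by (intro convex_closure_interior convex_convex_hull) auto
  also have "\<dots> = convex hull (set (quad h \<epsilon>\<^sub>1 \<epsilon>\<^sub>2))"
    by (intro closure_closed compact_imp_closed finite_imp_compact_convex_hull) simp
  finally show ?thesis
    by (simp add: hull_quad[OF assms])
qed

lemma kappa_quad:
  assumes "0 < h" "0 < \<epsilon>\<^sub>1" "\<epsilon>\<^sub>1 \<le> \<epsilon>\<^sub>2" "y \<in> {0..h}"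
  shows "kappa (quad h \<epsilon>\<^sub>1 \<epsilon>\<^sub>2) y = (h - y) * ((\<epsilon>\<^sub>2 - \<epsilon>\<^sub>1) / h) + \<epsilon>\<^sub>1"
proof -
  let ?K = "(h - y) * ((\<epsilon>\<^sub>2 - \<epsilon>\<^sub>1) / h) + \<epsilon>\<^sub>1"
  have "0 \<le> (h - y) * ((\<epsilon>\<^sub>2 - \<epsilon>\<^sub>1) / h)"
    using assms by (intro mult_nonneg_nonneg) auto
  then have "0 \<le> ?K"
    using assms(2) by linarith
  moreover have "{x. (x, y) \<in> closure (polygon (quad h \<epsilon>\<^sub>1 \<epsilon>\<^sub>2))} = {0..?K}"
    using assms(4) by (auto simp: closure_polygon_quad[OF assms(1-3)])
  ultimately show ?thesis
    by (simp add: kappa_def)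
qed

section \<open>Passage to the limit along the smooth approximations\<close>

lemma s_form_le_H1_seminorm:
  assumes "0 < h" "0 < \<epsilon>\<^sub>1" "\<epsilon>\<^sub>1 \<le> \<epsilon>\<^sub>2"
    and tr: "has_trace (quad h \<epsilon>\<^sub>1 \<epsilon>\<^sub>2) v (bd_trace (quad h \<epsilon>\<^sub>1 \<epsilon>\<^sub>2) v)"
    and zero: "AE_edge ((\<epsilon>\<^sub>2, 0), (\<epsilon>\<^sub>1, h)) (\<lambda>x. bd_trace (quad h \<epsilon>\<^sub>1 \<epsilon>\<^sub>2) v x = 0)"
  shows "s_form h (quad h \<epsilon>\<^sub>1 \<epsilon>\<^sub>2) v v \<le> (H1_seminorm (polygon (quad h \<epsilon>\<^sub>1 \<epsilon>\<^sub>2)) v)\<^sup>2"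
proof -
  let ?ps = "quad h \<epsilon>\<^sub>1 \<epsilon>\<^sub>2"
  let ?E = "polygon ?ps" and ?I = "lebesgue_on {0..h}"
  define g where "g = bd_trace ?ps v"
  define K where "K y = (h - y) * ((\<epsilon>\<^sub>2 - \<epsilon>\<^sub>1) / h) + \<epsilon>\<^sub>1" for y
  have K_ge: "\<epsilon>\<^sub>1 \<le> K y" if "y \<in> {0..h}" for y
    using assms that by (auto simp: K_def)
  have K_cont: "continuous_on S K" for S
    unfolding K_def by (intro continuous_intros)
  obtain \<phi> where \<phi>: "\<And>n. smooth (\<phi> n)"
    and grad: "L2_tendsto (lebesgue_on ?E) (\<lambda>n. gradient (\<phi> n)) (weak_gradient ?E v)"
    and edge: "\<And>a b. (a, b) \<in> set (edges ?ps) \<Longrightarrow>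
        L2_tendsto (lebesgue_on {0..1}) (\<lambda>n t. \<phi> n (linepath a b t)) (\<lambda>t. g (linepath a b t))"
    using tr unfolding has_trace_def g_def by blast
  have left: "L2_tendsto ?I (\<lambda>n y. \<phi> n (0, y)) (\<lambda>y. g (0, y))"
  proof -
    \<comment> \<open>The left edge is traversed downwards, so height \<open>y\<close> has parameter
      \<open>1 - y / h\<close>.\<close>
    have path: "linepath (0, h) (0, 0) (1 + (-1 / h) * y) = (0, y)" for y :: real
      using assms(1) by (simp add: linepath_def)
    have "L2_tendsto (lebesgue_on {0..1}) (\<lambda>n t. \<phi> n (linepath (0, h) (0, 0) t)) (\<lambda>t. g (linepath (0, h) (0, 0) t))"
      by (rule edge) (simp add: edges_def quad_def)
    from L2_tendsto_real_affine[OF this, of "-1 / h" "{0..h}" 1] show ?thesis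
      using assms(1) unfolding path by (auto simp: field_simps)
  qed
  have right: "L2_tendsto ?I (\<lambda>n y. \<phi> n (K y, y)) (\<lambda>y. 0)"
  proof -
    \<comment> \<open>The slanted edge is traversed upwards, so height \<open>y\<close> has
      parameter \<open>y / h\<close>.\<close>
    have path: "linepath (\<epsilon>\<^sub>2, 0) (\<epsilon>\<^sub>1, h) (0 + (1 / h) * y) = (K y, y)" for y :: real
      using assms(1) by (simp add: linepath_def K_def field_simps)
    have "L2_tendsto (lebesgue_on {0..1}) (\<lambda>n t. \<phi> n (linepath (\<epsilon>\<^sub>2, 0) (\<epsilon>\<^sub>1, h) t)) (\<lambda>t. 0)"
      using zero
      by (intro L2_tendsto_cong_AE[OF edge]) (auto simp: edges_def quad_def AE_edge_def g_def)
    from L2_tendsto_real_affine[OF this, of "1 / h" "{0..h}" 0] show ?thesis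
      using assms(1) unfolding path by (simp add: field_simps)
  qed
  \<comment> \<open>With this weight the integral with denominator \<open>K\<close> becomes a plain
    squared L2 norm; \<open>c\<close> is bounded by \<open>1 / sqrt \<epsilon>\<^sub>1\<close> on
    \<open>{0..h}\<close>, so it preserves L2 convergence.\<close>
  define c where "c y = 1 / sqrt (K y)" for y
  have c_sq: "(c y)\<^sup>2 = 1 / K y" if "y \<in> {0..h}" for y
    using K_ge[OF that] assms(2) by (simp add: c_def power_divide)
  have lim: "L2_tendsto ?I (\<lambda>n y. c y * (\<phi> n (0, y) - \<phi> n (K y, y))) (\<lambda>y. c y * (g (0, y) - 0))"
  proof (rule L2_tendsto_mult_bounded[OF L2_tendsto_diff[OF left right]])
    have "continuous_on {0..h} c"
      unfolding c_def using K_ge assms(2) by (intro continuous_intros K_cont) force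
    then show "c \<in> borel_measurable ?I"
      by (intro continuous_imp_measurable_on_sets_lebesgue) auto
    show "\<bar>c y\<bar> \<le> 1 / sqrt \<epsilon>\<^sub>1" if "y \<in> space ?I" for y
      using K_ge[of y] that assms(2) by (simp add: c_def frac_le)
  qed
  have D: "(\<integral>y. (norm (c y * u y))\<^sup>2 \<partial>?I) = (\<integral>y. (u y)\<^sup>2 / K y \<partial>?I)"
      "integrable ?I (\<lambda>y. (norm (c y * u y))\<^sup>2) \<longleftrightarrow> integrable ?I (\<lambda>y. (u y)\<^sup>2 / K y)" for u
    by (auto intro!: Bochner_Integration.integral_cong Bochner_Integration.integrable_cong
        simp: power_mult_distrib c_sq)
  \<comment> \<open>This holds for each approximation, whatever its values on the slanted edge. The
    boundary condition enters only through the limit 0 in \<open>right\<close>.\<close>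
  have le: "(\<integral>y. (norm (c y * (\<phi> n (0, y) - \<phi> n (K y, y))))\<^sup>2 \<partial>?I)
      \<le> (\<integral>z. (norm (gradient (\<phi> n) z))\<^sup>2 \<partial>lebesgue_on ?E)" for n
    unfolding D
  proof (rule slice_increment_le_gradient[OF \<phi> K_cont])
    show "{(x, y). 0 < y \<and> y < h \<and> 0 < x \<and> x < K y} \<subseteq> ?E"
      unfolding K_def by (rule interior_subset_polygon_quad[OF assms(1-3)])
    show "?E \<in> sets lebesgue"
      by (simp add: polygon_def)
    show "integrable ?I (\<lambda>y. (\<phi> n (0, y) - \<phi> n (K y, y))\<^sup>2 / K y)"
      unfolding D[symmetric] using lim by (intro L2_integrable) (auto simp: L2_tendsto_def)
    show "integrable (lebesgue_on ?E) (\<lambda>z. (norm (gradient (\<phi> n) z))\<^sup>2)"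
      using grad by (intro L2_integrable) (auto simp: L2_tendsto_def)
    show "0 < K y" if "y \<in> {0<..<h}" for y
      using K_ge[of y] that assms(2) by auto
    show "0 \<le> K y" if "y \<in> {0..h}" for y
      using K_ge[of y] that assms(2) by auto
  qed
  have "s_form h ?ps v v = (\<integral>y. (norm (c y * (g (0, y) - 0)))\<^sup>2 \<partial>?I)"
    unfolding s_form_def D using kappa_quad[OF assms(1-3)]
    by (intro Bochner_Integration.integral_cong) (auto simp: g_def K_def power2_eq_square)
  \<comment> \<open>Both sides of \<open>le\<close> converge. By the definition of
    \<open>has_trace\<close>, the gradients tend to the very representative
    \<open>weak_gradient ?E v\<close> that occurs in the seminorm.\<close>
  also have "\<dots> \<le> (\<integral>z. (norm (weak_gradient ?E v z))\<^sup>2 \<partial>lebesgue_on ?E)"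
    by (rule LIMSEQ_le[OF L2_tendsto_integral_norm[OF lim] L2_tendsto_integral_norm[OF grad]])
       (use le in auto)
  also have "\<dots> = (H1_seminorm ?E v)\<^sup>2"
    by (simp add: H1_seminorm_def)
  finally show ?thesis .
qed

theorem lemma6p2:
  fixes h \<epsilon>\<^sub>1 \<epsilon>\<^sub>2 :: real
  assumes "0 < \<epsilon>\<^sub>1" and "\<epsilon>\<^sub>1 \<le> \<epsilon>\<^sub>2" and "\<epsilon>\<^sub>2 \<le> h"
  shows "(\<forall>y\<in>{0..h}. kappa (quad h \<epsilon>\<^sub>1 \<epsilon>\<^sub>2) y = (h - y) * ((\<epsilon>\<^sub>2 - \<epsilon>\<^sub>1) / h) + \<epsilon>\<^sub>1) \<and>
    (\<forall>v\<in>VEM (quad h \<epsilon>\<^sub>1 \<epsilon>\<^sub>2).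
       AE_edge ((\<epsilon>\<^sub>2, 0), (\<epsilon>\<^sub>1, h)) (\<lambda>x. bd_trace (quad h \<epsilon>\<^sub>1 \<epsilon>\<^sub>2) v x = 0) \<longrightarrow>
       s_form h (quad h \<epsilon>\<^sub>1 \<epsilon>\<^sub>2) v v \<le> (H1_seminorm (polygon (quad h \<epsilon>\<^sub>1 \<epsilon>\<^sub>2)) v)\<^sup>2)"
proof (intro conjI ballI impI)
  have h: "0 < h" using assms by linarith
  show "kappa (quad h \<epsilon>\<^sub>1 \<epsilon>\<^sub>2) y = (h - y) * ((\<epsilon>\<^sub>2 - \<epsilon>\<^sub>1) / h) + \<epsilon>\<^sub>1" if "y \<in> {0..h}" for y
    by (rule kappa_quad[OF h assms(1,2) that])
  fix v assume "v \<in> VEM (quad h \<epsilon>\<^sub>1 \<epsilon>\<^sub>2)"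
    and zero: "AE_edge ((\<epsilon>\<^sub>2, 0), (\<epsilon>\<^sub>1, h)) (\<lambda>x. bd_trace (quad h \<epsilon>\<^sub>1 \<epsilon>\<^sub>2) v x = 0)"
  \<comment> \<open>\<open>bd_trace\<close> is a choice, so a trace must be known to exist before
    the chosen function is one; membership in \<open>VEM\<close> supplies it.\<close>
  then have "\<exists>g. has_trace (quad h \<epsilon>\<^sub>1 \<epsilon>\<^sub>2) v g"
    by (auto simp: VEM_def)
  then have "has_trace (quad h \<epsilon>\<^sub>1 \<epsilon>\<^sub>2) v (bd_trace (quad h \<epsilon>\<^sub>1 \<epsilon>\<^sub>2) v)"
    unfolding bd_trace_def by (rule someI_ex)
  then show "s_form h (quad h \<epsilon>\<^sub>1 \<epsilon>\<^sub>2) v v \<le> (H1_seminorm (polygon (quad h \<epsilon>\<^sub>1 \<epsilon>\<^sub>2)) v)\<^sup>2"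
    by (rule s_form_le_H1_seminorm[OF h assms(1,2) _ zero])
qed

end
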